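(* Let $\mathcal H$ be a complex separable infinite dimensional Hilbert space. (1) Let $\Phi:\ell_\infty(\mathbb N,\mathcal B(\mathcal H))\to\ell_\infty(\mathbb N,\mathcal B(\mathcal H))$ be an automorphism. Then there are automorphisms $\phi_n$ $(n\in\mathbb N)$ of $\mathcal B(\mathcal H)$ and a bijection $\varphi:\mathbb N\to\mathbb N$ such that $$\Phi((A_k)_k)=(\phi_n(A_{\varphi(n)}))_n\qquad ((A_k)_k\in\ell_\infty(\mathbb N,\mathcal B(\mathcal H))).$$ (2) Let $\Phi:\ell_\infty(\mathbb N,\mathcal B(\mathcal H))\to\ell_\infty(\mathbb N,\mathcal B(\mathcal H))$ be a surjective linear isometry. Then there are surjective linear isometries $\phi_n$ $(n\in\mathbb N)$ of $\mathcal B(\mathcal H)$ and a bijection $\varphi:\mathbb N\to\mathbb N$ such that $$\Phi((A_k)_k)=(\phi_n(A_{\varphi(n)}))_n\qquad ((A_k)_k\in\ell_\infty(\mathbb N,\mathcal B(\mathcal H))).$$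
   Context: $\mathcal B(\mathcal H)$ denotes the $C^*$-algebra of all bounded linear operators on $\mathcal H$. $\ell_\infty(\mathbb N,\mathcal B(\mathcal H))=\{(A_n)_n : A_n\in\mathcal B(\mathcal H)\ (n\in\mathbb N),\ \sup_n\|A_n\|<\infty\}$ is a $C^*$-algebra with coordinatewise operations and the supremum norm. An automorphism of an algebra is a multiplicative linear bijection of the algebra onto itself; it is not assumed to preserve the involution. *)

theory Defs
  imports "HOL-Analysis.Analysis"
begin

section \<open>Complex vector spaces, algebras and Hilbert spaces\<close>

class complex_vector = real_vector +
  fixes scaleC :: "complex \<Rightarrow> 'a \<Rightarrow> 'a" (infixr \<open>*\<^sub>C\<close> 75)
  assumes scaleC_add_right: "a *\<^sub>C (x + y) = a *\<^sub>C x + a *\<^sub>C y"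
    and scaleC_add_left: "(a + b) *\<^sub>C x = a *\<^sub>C x + b *\<^sub>C x"
    and scaleC_scaleC: "a *\<^sub>C b *\<^sub>C x = (a * b) *\<^sub>C x"
    and scaleC_one: "1 *\<^sub>C x = x"
    and scaleR_scaleC: "r *\<^sub>R x = complex_of_real r *\<^sub>C x"

global_interpretation complex_vector:
  vector_space "scaleC :: complex \<Rightarrow> 'a \<Rightarrow> 'a::complex_vector"
  defines cspan = complex_vector.span
  by unfold_locales
    (simp_all add: scaleC_add_right scaleC_add_left scaleC_scaleC scaleC_one)

abbreviation clinear :: "('a::complex_vector \<Rightarrow> 'b::complex_vector) \<Rightarrow> bool"
  where "clinear \<equiv> Vector_Spaces.linear (*\<^sub>C) (*\<^sub>C)"

class complex_normed_vector = complex_vector + real_normed_vector +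
  assumes norm_scaleC: "norm (a *\<^sub>C x) = cmod a * norm x"

class complex_algebra = complex_vector + ring +
  assumes mult_scaleC_left: "(a *\<^sub>C x) * y = a *\<^sub>C (x * y)"
    and mult_scaleC_right: "x * (a *\<^sub>C y) = a *\<^sub>C (x * y)"

class complex_normed_algebra = complex_algebra + complex_normed_vector + real_normed_algebra

text \<open>The inner product is linear in its first argument. Positive definiteness is part of
  \<open>cinner_self\<close>, since the norm is already known to be one.\<close>

class complex_inner = complex_normed_vector +
  fixes cinner :: "'a \<Rightarrow> 'a \<Rightarrow> complex"
  assumes cinner_commute: "cinner x y = cnj (cinner y x)"
    and cinner_add_left: "cinner (x + y) z = cinner x z + cinner y z"
    and cinner_scaleC_left: "cinner (a *\<^sub>C x) y = a * cinner x y"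
    and cinner_self: "cinner x x = complex_of_real ((norm x)\<^sup>2)"

class complex_hilbert_space = complex_inner + complete_space

lemma clinear_iff:
  "clinear f \<longleftrightarrow> (\<forall>x y. f (x + y) = f x + f y) \<and> (\<forall>c x. f (c *\<^sub>C x) = c *\<^sub>C f x)"
  by (auto simp: Vector_Spaces.linear_iff complex_vector.vector_space_axioms)

lemma clinear_imp_linear: "clinear f \<Longrightarrow> linear f"
  by (intro linearI) (auto simp: clinear_iff scaleR_scaleC)


section \<open>The algebra of bounded operators\<close>

definition bounded_clinear :: "('a::complex_normed_vector \<Rightarrow> 'b::complex_normed_vector) \<Rightarrow> bool"
  where "bounded_clinear f \<longleftrightarrow> clinear f \<and> (\<exists>K. \<forall>x. norm (f x) \<le> norm x * K)"

lemma bounded_clinear_iff: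
  "bounded_clinear f \<longleftrightarrow> bounded_linear f \<and> (\<forall>c x. f (c *\<^sub>C x) = c *\<^sub>C f x)"
  by (auto simp: bounded_clinear_def bounded_linear_def bounded_linear_axioms_def clinear_imp_linear)
     (auto simp: clinear_iff linear_add)

typedef (overloaded) 'h bounded_op =
  "{f :: 'h::complex_normed_vector \<Rightarrow> 'h. bounded_clinear f}"
  morphisms op_apply Abs_bounded_op
  by (rule exI[of _ "\<lambda>_. 0"])
     (simp add: bounded_clinear_iff bounded_linear_zero complex_vector.scale_zero_right)

setup_lifting type_definition_bounded_op

declare [[coercion op_apply]]

lemma bounded_op_eqI: "(\<And>x. op_apply A x = op_apply B x) \<Longrightarrow> A = B"
  by transfer auto

lemma bounded_clinear_op_apply: "bounded_clinear (op_apply A)"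
  using op_apply[of A] by simp

lemma bounded_linear_op_apply: "bounded_linear (op_apply A)"
  using bounded_clinear_op_apply[of A] by (simp add: bounded_clinear_iff)

instantiation bounded_op :: (complex_normed_vector) complex_normed_algebra
begin

lift_definition norm_bounded_op :: "'a bounded_op \<Rightarrow> real" is onorm .

lift_definition zero_bounded_op :: "'a bounded_op" is "\<lambda>_. 0"
  by (simp add: bounded_clinear_iff bounded_linear_zero complex_vector.scale_zero_right)

lift_definition plus_bounded_op :: "'a bounded_op \<Rightarrow> 'a bounded_op \<Rightarrow> 'a bounded_op"
  is "\<lambda>f g x. f x + g x"
  by (simp add: bounded_clinear_iff bounded_linear_add scaleC_add_right)

lift_definition minus_bounded_op :: "'a bounded_op \<Rightarrow> 'a bounded_op \<Rightarrow> 'a bounded_op"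
  is "\<lambda>f g x. f x - g x"
  by (simp add: bounded_clinear_iff bounded_linear_sub complex_vector.scale_right_diff_distrib)

lift_definition uminus_bounded_op :: "'a bounded_op \<Rightarrow> 'a bounded_op"
  is "\<lambda>f x. - f x"
  by (simp add: bounded_clinear_iff bounded_linear_minus complex_vector.scale_minus_right)

lift_definition times_bounded_op :: "'a bounded_op \<Rightarrow> 'a bounded_op \<Rightarrow> 'a bounded_op"
  is "\<lambda>f g x. f (g x)"
  by (simp add: bounded_clinear_iff bounded_linear_compose)

lift_definition scaleC_bounded_op :: "complex \<Rightarrow> 'a bounded_op \<Rightarrow> 'a bounded_op"
  is "\<lambda>c f x. c *\<^sub>C f x"
proof -
  fix c :: complex and f :: "'a \<Rightarrow> 'a"
  assume "bounded_clinear f"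
  then obtain K where f: "clinear f" and K: "\<And>x. norm (f x) \<le> norm x * K"
    by (auto simp: bounded_clinear_def)
  have "norm (c *\<^sub>C f x) \<le> norm x * (cmod c * K)" for x
    using mult_left_mono[OF K[of x] norm_ge_zero[of c]] by (simp add: norm_scaleC mult_ac)
  then show "bounded_clinear (\<lambda>x. c *\<^sub>C f x)"
    using f unfolding bounded_clinear_def clinear_iff
    by (intro conjI exI[of _ "cmod c * K"]) (simp_all add: scaleC_add_right scaleC_scaleC mult.commute)
qed

definition scaleR_bounded_op :: "real \<Rightarrow> 'a bounded_op \<Rightarrow> 'a bounded_op"
  where "scaleR_bounded_op r A = complex_of_real r *\<^sub>C A"

definition sgn_bounded_op :: "'a bounded_op \<Rightarrow> 'a bounded_op"
  where "sgn_bounded_op A = inverse (norm A) *\<^sub>R A"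

definition dist_bounded_op :: "'a bounded_op \<Rightarrow> 'a bounded_op \<Rightarrow> real"
  where "dist_bounded_op A B = norm (A - B)"

definition uniformity_bounded_op :: "('a bounded_op \<times> 'a bounded_op) filter"
  where "uniformity_bounded_op = (INF e\<in>{0 <..}. principal {(x, y). dist x y < e})"

definition open_bounded_op :: "'a bounded_op set \<Rightarrow> bool"
  where "open_bounded_op S = (\<forall>x\<in>S. \<forall>\<^sub>F (x', y) in uniformity. x' = x \<longrightarrow> y \<in> S)"

instance
proof
  fix A B C :: "'a bounded_op" and a b :: complex and r s :: real
  show "A + B + C = A + (B + C)" "A + B = B + A" "0 + A = A" "- A + A = 0" "A - B = A + - B"
    by (transfer, simp add: add_ac)+
  have *: "a *\<^sub>C (A + B) = a *\<^sub>C A + a *\<^sub>C B" "(a + b) *\<^sub>C A = a *\<^sub>C A + b *\<^sub>C A" for A B :: "'a bounded_op" and a b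
    by (transfer, simp add: scaleC_add_right scaleC_add_left)+
  have **: "a *\<^sub>C b *\<^sub>C A = (a * b) *\<^sub>C A" "1 *\<^sub>C A = A" for A :: "'a bounded_op" and a b
    by (transfer, simp add: scaleC_scaleC scaleC_one)+
  show "a *\<^sub>C (A + B) = a *\<^sub>C A + a *\<^sub>C B" "(a + b) *\<^sub>C A = a *\<^sub>C A + b *\<^sub>C A"
    "a *\<^sub>C b *\<^sub>C A = (a * b) *\<^sub>C A" "1 *\<^sub>C A = A"
    by (simp_all only: * **)
  show "r *\<^sub>R A = complex_of_real r *\<^sub>C A"
    by (simp add: scaleR_bounded_op_def)
  show "r *\<^sub>R (A + B) = r *\<^sub>R A + r *\<^sub>R B" "(r + s) *\<^sub>R A = r *\<^sub>R A + s *\<^sub>R A"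
    "r *\<^sub>R s *\<^sub>R A = (r * s) *\<^sub>R A" "1 *\<^sub>R A = A"
    by (simp_all add: scaleR_bounded_op_def * **)
  show "A * B * C = A * (B * C)"
    by transfer simp
  show "(A + B) * C = A * C + B * C"
    by transfer simp
  show "A * (B + C) = A * B + A * C"
    by transfer (auto simp: bounded_clinear_def clinear_iff)
  show "(a *\<^sub>C A) * B = a *\<^sub>C (A * B)"
    by transfer simp
  show cr: "A * (a *\<^sub>C B) = a *\<^sub>C (A * B)" for A B :: "'a bounded_op" and a
    by transfer (auto simp: bounded_clinear_def clinear_iff)
  show "(r *\<^sub>R A) * B = r *\<^sub>R (A * B)"
    unfolding scaleR_bounded_op_def by transfer simp
  show "A * (r *\<^sub>R B) = r *\<^sub>R (A * B)"
    by (simp add: scaleR_bounded_op_def cr)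
  show "norm A = 0 \<longleftrightarrow> A = 0"
    by transfer (auto simp: onorm_eq_0 bounded_clinear_iff)
  show "norm (A + B) \<le> norm A + norm B"
    by transfer (auto intro!: onorm_triangle simp: bounded_clinear_iff)
  show "norm (A * B) \<le> norm A * norm B"
    by transfer (use onorm_compose in \<open>force simp: bounded_clinear_iff o_def\<close>)
  have le: "norm (a *\<^sub>C A) \<le> cmod a * norm A" for a and A :: "'a bounded_op"
  proof (transfer, rule onorm_bound)
    fix a and f :: "'a \<Rightarrow> 'a" and x
    assume f: "bounded_clinear f"
    then show "0 \<le> cmod a * onorm f"
      by (simp add: bounded_clinear_iff onorm_pos_le)
    from f have "norm (f x) \<le> onorm f * norm x"
      by (simp add: bounded_clinear_iff onorm)
    then show "norm (a *\<^sub>C f x) \<le> cmod a * onorm f * norm x"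
      by (simp add: norm_scaleC mult.assoc mult_left_mono)
  qed
  show nC: "norm (a *\<^sub>C A) = cmod a * norm A" for a and A :: "'a bounded_op"
  proof (cases "a = 0")
    case True
    then show ?thesis
      by transfer (simp add: complex_vector.scale_zero_left onorm_zero)
  next
    case False
    have "norm A = norm (inverse a *\<^sub>C a *\<^sub>C A)"
      using False by (simp add: **)
    also have "\<dots> \<le> cmod (inverse a) * norm (a *\<^sub>C A)"
      by (rule le)
    finally have "cmod a * norm A \<le> norm (a *\<^sub>C A)"
      using False by (simp add: norm_inverse norm_divide field_simps)
    with le[of a A] show ?thesis by simp
  qed
  show "norm (r *\<^sub>R A) = \<bar>r\<bar> * norm A"
    by (simp add: scaleR_bounded_op_def nC)
qed (rule sgn_bounded_op_def dist_bounded_op_def uniformity_bounded_op_def open_bounded_op_def)+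

end


section \<open>The algebra of bounded sequences\<close>

text \<open>For an algebra \<open>'b\<close>, the algebra \<open>\<ell>\<^sub>\<infinity>(\<nat>, 'b)\<close> is the library type \<open>nat \<Rightarrow>\<^sub>C 'b\<close> of bounded
  continuous functions, whose norm is the supremum norm: \<open>nat\<close> is discrete, so continuity is no
  restriction.\<close>

lemma range_apply_bcontfun_nat:
  "range (apply_bcontfun :: (nat \<Rightarrow>\<^sub>C 'b::metric_space) \<Rightarrow> _) = {f. bounded (range f)}"
proof -
  have "range (apply_bcontfun :: (nat \<Rightarrow>\<^sub>C 'b) \<Rightarrow> _) = bcontfun"
    by (rule type_definition.Rep_range[OF type_definition_bcontfun])
  then show ?thesis
    by (simp add: bcontfun_def continuous_on_discrete)
qed

lemma norm_bcontfun_eq_SUP: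
  fixes f :: "'a::topological_space \<Rightarrow>\<^sub>C 'b::real_normed_vector"
  shows "norm f = (SUP x. norm (apply_bcontfun f x))"
  by (simp add: norm_bcontfun_def dist_bcontfun.rep_eq)

setup_lifting type_definition_bcontfun

instantiation bcontfun :: (topological_space, complex_normed_vector) complex_normed_vector
begin

lift_definition scaleC_bcontfun :: "complex \<Rightarrow> ('a \<Rightarrow>\<^sub>C 'b) \<Rightarrow> 'a \<Rightarrow>\<^sub>C 'b"
  is "\<lambda>c f x. c *\<^sub>C f x"
proof -
  fix c :: complex and f :: "'a \<Rightarrow> 'b"
  assume f: "f \<in> bcontfun"
  have bl: "bounded_linear (\<lambda>x::'b. c *\<^sub>C x)"
    by (rule bounded_linear_intro[of _ "cmod c"])
       (simp_all add: scaleC_add_right scaleR_scaleC scaleC_scaleC norm_scaleC mult.commute)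
  have "continuous_on UNIV (\<lambda>x. c *\<^sub>C f x)"
    using f by (intro bounded_linear.continuous_on[OF bl]) (simp add: bcontfun_def)
  moreover have "bounded ((\<lambda>x. c *\<^sub>C x) ` range f)"
    using f by (intro bounded_linear_image[OF _ bl]) (simp add: bcontfun_def)
  ultimately show "(\<lambda>x. c *\<^sub>C f x) \<in> bcontfun"
    by (simp add: bcontfun_def image_image)
qed

instance
proof
  fix f g :: "'a \<Rightarrow>\<^sub>C 'b" and a b :: complex and r :: real
  show "a *\<^sub>C (f + g) = a *\<^sub>C f + a *\<^sub>C g" "(a + b) *\<^sub>C f = a *\<^sub>C f + b *\<^sub>C f"
    "a *\<^sub>C b *\<^sub>C f = (a * b) *\<^sub>C f" "1 *\<^sub>C f = f" "r *\<^sub>R f = complex_of_real r *\<^sub>C f"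
    by (rule bcontfun_eqI, simp add: scaleC_bcontfun.rep_eq plus_bcontfun.rep_eq
        scaleR_bcontfun.rep_eq scaleC_add_right scaleC_add_left scaleC_scaleC scaleC_one
        scaleR_scaleC)+
  have le: "norm (a *\<^sub>C f) \<le> cmod a * norm f" for a and f :: "'a \<Rightarrow>\<^sub>C 'b"
    by (rule norm_bound) (simp add: scaleC_bcontfun.rep_eq norm_scaleC mult_left_mono norm_bounded)
  show "norm (a *\<^sub>C f) = cmod a * norm f"
  proof (cases "a = 0")
    case True
    then show ?thesis
      using le[of a f] by simp
  next
    case False
    have "f = inverse a *\<^sub>C a *\<^sub>C f"
      using False by (intro bcontfun_eqI)
        (simp add: scaleC_bcontfun.rep_eq scaleC_scaleC scaleC_one)
    then have "norm f \<le> cmod (inverse a) * norm (a *\<^sub>C f)"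
      using le[of "inverse a" "a *\<^sub>C f"] by simp
    then have "cmod a * norm f \<le> norm (a *\<^sub>C f)"
      using False by (simp add: norm_inverse norm_divide field_simps)
    with le[of a f] show ?thesis by simp
  qed
qed

end

instantiation bcontfun :: (topological_space, complex_normed_algebra) complex_normed_algebra
begin

lift_definition times_bcontfun :: "('a \<Rightarrow>\<^sub>C 'b) \<Rightarrow> ('a \<Rightarrow>\<^sub>C 'b) \<Rightarrow> 'a \<Rightarrow>\<^sub>C 'b"
  is "\<lambda>f g x. f x * g x"
proof -
  fix f g :: "'a \<Rightarrow> 'b"
  assume f: "f \<in> bcontfun" and g: "g \<in> bcontfun"
  then obtain K L where K: "\<And>x. norm (f x) \<le> K" and L: "\<And>x. norm (g x) \<le> L"
    by (auto simp: bcontfun_def bounded_iff)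
  have "norm (f x * g x) \<le> K * L" for x
    by (rule order_trans[OF norm_mult_ineq])
       (intro mult_mono K L norm_ge_zero order_trans[OF norm_ge_zero K])
  moreover have "continuous_on UNIV (\<lambda>x. f x * g x)"
    using f g by (intro continuous_on_mult) (simp_all add: bcontfun_def)
  ultimately show "(\<lambda>x. f x * g x) \<in> bcontfun"
    by (intro bcontfun_normI)
qed

instance
proof
  fix f g h :: "'a \<Rightarrow>\<^sub>C 'b" and a :: complex and r :: real
  show "f * g * h = f * (g * h)" "(f + g) * h = f * h + g * h" "f * (g + h) = f * g + f * h"
    "(a *\<^sub>C f) * g = a *\<^sub>C (f * g)" "f * (a *\<^sub>C g) = a *\<^sub>C (f * g)"
    "(r *\<^sub>R f) * g = r *\<^sub>R (f * g)" "f * (r *\<^sub>R g) = r *\<^sub>R (f * g)"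
    by (rule bcontfun_eqI, simp add: times_bcontfun.rep_eq scaleC_bcontfun.rep_eq
        plus_bcontfun.rep_eq scaleR_bcontfun.rep_eq mult.assoc distrib_left distrib_right
        mult_scaleC_left mult_scaleC_right)+
  show "norm (f * g) \<le> norm f * norm g"
    by (rule norm_bound, unfold times_bcontfun.rep_eq, rule order_trans[OF norm_mult_ineq])
       (intro mult_mono norm_bounded norm_ge_zero)
qed

end


section \<open>Automorphisms and surjective linear isometries\<close>

definition algebra_automorphism :: "('a::complex_algebra \<Rightarrow> 'a) \<Rightarrow> bool"
  where "algebra_automorphism f \<longleftrightarrow> clinear f \<and> (\<forall>x y. f (x * y) = f x * f y) \<and> bij f"

definition surj_linear_isometry :: "('a::complex_normed_vector \<Rightarrow> 'a) \<Rightarrow> bool"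
  where "surj_linear_isometry f \<longleftrightarrow> clinear f \<and> (\<forall>x y. dist (f x) (f y) = dist x y) \<and> surj f"

end

theory Submission
  imports Defs
begin

text \<open>
  Write \<open>E\<^sub>k\<close> for the map that keeps the \<open>k\<close>-th coordinate of a bounded sequence and replaces all
  others by zero. Everything comes down to showing that \<open>\<Phi>\<close> permutes these maps by conjugation: if
  \<open>E\<^sub>n \<circ> \<Phi> = \<Phi> \<circ> E\<^bsub>\<sigma>(n)\<^esub>\<close> with \<open>\<sigma>\<close> bijective, then the \<open>n\<close>-th coordinate of \<open>\<Phi>(A)\<close> depends on
  \<open>A\<^bsub>\<sigma>(n)\<^esub>\<close> only, and the map \<open>\<phi>\<^sub>n\<close> so obtained inherits from \<open>\<Phi>\<close> whatever structure it preserves.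

  The conjugate \<open>Q = \<Phi> \<circ> E\<^sub>k \<circ> \<Phi>\<^sup>-\<^sup>1\<close> has every property of \<open>E\<^sub>k\<close> that can be expressed in the
  structure preserved by \<open>\<Phi>\<close>. In both cases one such property forces \<open>Q\<close> to be the restriction to
  some set of coordinates, because \<open>\<B>(\<H>)\<close> cannot be decomposed further.

  For an automorphism, \<open>Q\<close> is a linear idempotent with \<open>Q(AB) = A Q(B) = Q(A) B\<close>. Hence
  \<open>Q(A) C (B - Q(B)) = A C Q(B - Q(B)) = 0\<close> for all \<open>A, B, C\<close>, and since \<open>\<B>(\<H>)\<close> is a prime ring
  (\<open>bounded_op_prime\<close>), at each coordinate either all \<open>Q(A)\<close> or all \<open>B - Q(B)\<close> vanish.

  For an isometry, \<open>Q\<close> is an M-projection: an idempotent with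
  \<open>\<parallel>Q(A) + (B - Q(B))\<parallel> \<le> max \<parallel>A\<parallel> \<parallel>B\<parallel>\<close>. For unit vectors \<open>x, y\<close> let \<open>f(A) = \<langle>A\<^sub>n x, y\<rangle>\<close>; it attains
  its norm at the sequence \<open>R\<close> whose only nonzero entry is the operator \<open>z \<mapsto> \<langle>z, x\<rangle> y\<close> at coordinate
  \<open>n\<close>. If \<open>f(A) = 0\<close>, the perturbation \<open>R + t A\<close> has norm at most \<open>1 + O(\<bar>t\<bar>\<^sup>2)\<close>, by Pythagoras; the
  M-projection inequality passes this bound to \<open>R + t Q(A)\<close>, and so the first-order term
  \<open>t f(Q(A))\<close> must vanish. Thus \<open>f \<circ> Q\<close> is a multiple of \<open>f\<close>, with factor \<open>0\<close> or \<open>1\<close> as \<open>Q\<close> is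
  idempotent (\<open>M_projection_eigenfunctional\<close>). The factor does not depend on \<open>x\<close> and \<open>y\<close>, since a
  vector space is not the union of two proper subspaces.

  Finally \<open>\<Phi>\<^sup>-\<^sup>1\<close> is a map of the same kind, and comparing the sets of coordinates that belong to
  \<open>\<Phi>\<close> with those that belong to \<open>\<Phi>\<^sup>-\<^sup>1\<close> shows that all of them are singletons
  (\<open>restriction_pullback\<close>).
\<close>

section \<open>Inner product geometry\<close>

lemma cinner_diff_left: "cinner (x - y) z = cinner x z - cinner y z"
  for x y z :: "'h::complex_inner"
  using cinner_add_left[of "x - y" y z] by simp

lemma cinner_diff_right: "cinner z (x - y) = cinner z x - cinner z y"
  for x y z :: "'h::complex_inner"
  by (metis cinner_commute cinner_diff_left complex_cnj_diff)

lemma cinner_scaleC_right: "cinner z (a *\<^sub>C x) = cnj a * cinner z x"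
  for x z :: "'h::complex_inner"
  by (metis cinner_commute cinner_scaleC_left complex_cnj_mult)

lemma cinner_zero_left [simp]: "cinner 0 z = 0" for z :: "'h::complex_inner"
  using cinner_diff_left[of z z z] by simp

lemma cinner_zero_right [simp]: "cinner z 0 = 0" for z :: "'h::complex_inner"
  using cinner_diff_right[of z z z] by simp

lemma cinner_self_eq_0_iff [simp]: "cinner x x = 0 \<longleftrightarrow> x = 0" for x :: "'h::complex_inner"
  by (simp add: cinner_self)

lemma Pythagoras_unit_vector:
  fixes v y :: "'h::complex_inner"
  assumes "norm y = 1"
  shows "(norm v)\<^sup>2 = (cmod (cinner v y))\<^sup>2 + (norm (v - cinner v y *\<^sub>C y))\<^sup>2"
proof -
  have "cinner y y = 1"
    using assms by (simp add: cinner_self)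
  then have "complex_of_real ((norm (v - cinner v y *\<^sub>C y))\<^sup>2)
      = cinner v v - cinner v y * cnj (cinner v y)"
    unfolding cinner_self[symmetric]
    by (simp add: cinner_diff_left cinner_diff_right cinner_scaleC_left cinner_scaleC_right
        cinner_commute[of y v] mult.commute)
  also have "\<dots> = complex_of_real ((norm v)\<^sup>2 - (cmod (cinner v y))\<^sup>2)"
    by (simp only: cinner_self complex_norm_square of_real_diff)
  finally show ?thesis
    unfolding of_real_eq_iff by simp
qed

lemma cmod_cinner_le_unit:
  fixes v y :: "'h::complex_inner"
  assumes "norm y = 1"
  shows "cmod (cinner v y) \<le> norm v"
  using Pythagoras_unit_vector[OF assms, of v] by (auto intro: power2_le_imp_le[OF _ norm_ge_zero])

lemma unit_vector_multiple:
  fixes y :: "'h::complex_normed_vector"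
  assumes "y \<noteq> 0"
  obtains u where "norm u = 1" "y = complex_of_real (norm y) *\<^sub>C u"
proof
  show "norm (sgn y) = 1" using assms by (simp add: norm_sgn)
  show "y = complex_of_real (norm y) *\<^sub>C sgn y"
    using assms by (simp add: sgn_div_norm flip: scaleR_scaleC)
qed

lemma Cauchy_Schwarz_cinner: "cmod (cinner v y) \<le> norm v * norm y"
  for v y :: "'h::complex_inner"
proof (cases "y = 0")
  case False
  then obtain u where u: "norm u = 1" "y = complex_of_real (norm y) *\<^sub>C u"
    by (rule unit_vector_multiple)
  have "cmod (cinner v y) = norm y * cmod (cinner v u)"
    by (subst u(2)) (simp add: cinner_scaleC_right norm_mult)
  then show ?thesis
    using mult_left_mono[OF cmod_cinner_le_unit[OF u(1), of v] norm_ge_zero[of y]]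
    by (simp add: mult.commute)
qed simp


section \<open>Rank-one operators\<close>

lemma op_apply_add [simp]: "op_apply A (x + y) = op_apply A x + op_apply A y"
  using bounded_linear_op_apply[of A] by (simp add: bounded_linear.linear linear_add)

lemma op_apply_diff [simp]: "op_apply A (x - y) = op_apply A x - op_apply A y"
  using bounded_linear_op_apply[of A] by (simp add: bounded_linear.linear linear_diff)

lemma op_apply_zero [simp]: "op_apply A 0 = 0"
  using bounded_linear_op_apply[of A] by (simp add: bounded_linear.linear linear_0)

lemma op_apply_scaleC [simp]: "op_apply A (c *\<^sub>C x) = c *\<^sub>C op_apply A x"
  using bounded_clinear_op_apply[of A] by (simp add: bounded_clinear_iff)

lemma norm_op_apply_le: "norm (op_apply A x) \<le> norm A * norm x"
  by (simp add: norm_bounded_op.rep_eq onorm bounded_linear_op_apply)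

lemmas op_apply_simps [simp] =
  zero_bounded_op.rep_eq plus_bounded_op.rep_eq minus_bounded_op.rep_eq times_bounded_op.rep_eq
  scaleC_bounded_op.rep_eq

lift_definition rank_one :: "'h::complex_inner \<Rightarrow> 'h \<Rightarrow> 'h bounded_op"
  is "\<lambda>x y z. cinner z y *\<^sub>C x"
proof -
  fix x y :: 'h
  have "norm (cinner z y *\<^sub>C x) \<le> norm z * (norm y * norm x)" for z
    using mult_right_mono[OF Cauchy_Schwarz_cinner[of z y] norm_ge_zero[of x]]
    by (simp add: norm_scaleC mult_ac)
  then show "bounded_clinear (\<lambda>z. cinner z y *\<^sub>C x)"
    unfolding bounded_clinear_def clinear_iff
    by (auto simp: cinner_add_left cinner_scaleC_left scaleC_add_left scaleC_scaleC)
qed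

text \<open>If \<open>X v \<noteq> 0\<close> and \<open>Y w \<noteq> 0\<close>, the rank-one operator that takes \<open>Y w\<close> to a multiple of \<open>v\<close>
  connects the two. This primeness is why \<open>\<B>(\<H>)\<close> has no nontrivial direct summand as an
  algebra.\<close>

lemma bounded_op_prime:
  fixes X Y :: "'h::complex_inner bounded_op"
  assumes "\<And>C. X * C * Y = 0"
  shows "X = 0 \<or> Y = 0"
proof (rule ccontr)
  assume "\<not> (X = 0 \<or> Y = 0)"
  then obtain v w where v: "op_apply X v \<noteq> 0" and w: "op_apply Y w \<noteq> 0"
    by (metis bounded_op_eqI zero_bounded_op.rep_eq)
  have "op_apply (X * rank_one v (op_apply Y w) * Y) w
      = cinner (op_apply Y w) (op_apply Y w) *\<^sub>C op_apply X v"
    by (simp add: rank_one.rep_eq)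
  with assms v w show False
    by simp
qed

text \<open>The condition \<open>\<langle>A x, y\<rangle> = 0\<close> says that \<open>A\<close> has no entry in the position occupied by the
  rank-one operator, and entries elsewhere contribute orthogonally: decompose the argument along
  \<open>x\<close> and the value along \<open>y\<close>. The norm therefore grows only to second order in \<open>t\<close>.\<close>

lemma norm_rank_one_perturbation:
  fixes x y :: "'h::complex_inner"
  assumes x: "norm x = 1" and y: "norm y = 1" and A: "cinner (op_apply A x) y = 0"
  shows "norm (rank_one y x + t *\<^sub>C A) \<le> sqrt (1 + 2 * (cmod t * norm A)\<^sup>2)"
proof -
  define m where "m = cmod t * norm A"
  have "norm (op_apply (rank_one y x + t *\<^sub>C A) z) \<le> sqrt (1 + 2 * m\<^sup>2) * norm z" for z
  proof -
    define v where "v = op_apply (rank_one y x + t *\<^sub>C A) z"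
    define \<alpha> where "\<alpha> = cinner z x"
    define w where "w = z - \<alpha> *\<^sub>C x"
    have z: "(norm z)\<^sup>2 = (cmod \<alpha>)\<^sup>2 + (norm w)\<^sup>2"
      unfolding \<alpha>_def w_def by (rule Pythagoras_unit_vector[OF x])
    have v: "v = \<alpha> *\<^sub>C y + t *\<^sub>C op_apply A z"
      by (simp add: v_def \<alpha>_def rank_one.rep_eq)
    have yy: "cinner y y = 1"
      using y by (simp add: cinner_self)
    \<comment> \<open>Along \<open>y\<close>, the operator \<open>A\<close> acts only on the part \<open>w\<close> of \<open>z\<close> orthogonal to \<open>x\<close>. Its
      contribution can then be combined with that of \<open>\<alpha>\<close> by Cauchy-Schwarz in \<open>\<real>\<^sup>2\<close>, which leaves
      no term linear in \<open>m\<close>.\<close>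
    have "cinner (op_apply A w) y = cinner (op_apply A z) y"
      using A by (simp add: w_def cinner_diff_left cinner_scaleC_left)
    then have vy: "cinner v y = \<alpha> + t * cinner (op_apply A w) y"
      by (simp add: v cinner_add_left cinner_scaleC_left yy)
    have "cmod (cinner (op_apply A w) y) \<le> norm A * norm w"
      using cmod_cinner_le_unit[OF y] norm_op_apply_le order_trans by blast
    then have "cmod (cinner v y) \<le> cmod \<alpha> + m * norm w"
      unfolding vy m_def mult.assoc
      by (intro norm_triangle_le add_left_mono) (simp add: norm_mult mult_left_mono)
    then have "(cmod (cinner v y))\<^sup>2 \<le> (cmod \<alpha> + m * norm w)\<^sup>2"
      by (rule power_mono) simp
    also have "\<dots> \<le> ((cmod \<alpha>)\<^sup>2 + (norm w)\<^sup>2) * (1 + m\<^sup>2)"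
      using zero_le_power2[of "m * cmod \<alpha> - norm w"]
      by (simp add: power2_eq_square algebra_simps)
    finally have along: "(cmod (cinner v y))\<^sup>2 \<le> (norm z)\<^sup>2 * (1 + m\<^sup>2)"
      by (simp only: z)
    \<comment> \<open>Orthogonally to \<open>y\<close> the rank-one operator contributes nothing.\<close>
    define u where "u = t *\<^sub>C op_apply A z"
    have "v - cinner v y *\<^sub>C y = u - cinner u y *\<^sub>C y"
      by (simp add: v u_def cinner_add_left cinner_scaleC_left yy scaleC_add_left)
    then have "(norm (v - cinner v y *\<^sub>C y))\<^sup>2 \<le> (norm u)\<^sup>2"
      using Pythagoras_unit_vector[OF y, of u] by simp
    also have "norm u \<le> m * norm z"
      unfolding u_def m_def mult.assoc norm_scaleC by (intro mult_left_mono norm_op_apply_le) simp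
    then have "(norm u)\<^sup>2 \<le> m\<^sup>2 * (norm z)\<^sup>2"
      using power_mono[of "norm u" "m * norm z" 2] by (simp add: power_mult_distrib)
    finally have across: "(norm (v - cinner v y *\<^sub>C y))\<^sup>2 \<le> m\<^sup>2 * (norm z)\<^sup>2" .
    have "(norm v)\<^sup>2 \<le> (1 + 2 * m\<^sup>2) * (norm z)\<^sup>2"
      using along across Pythagoras_unit_vector[OF y, of v] by (simp add: algebra_simps)
    then have "norm v \<le> sqrt ((1 + 2 * m\<^sup>2) * (norm z)\<^sup>2)"
      by (rule real_le_rsqrt)
    then show ?thesis
      by (simp add: v_def real_sqrt_mult)
  qed
  then show ?thesis
    unfolding norm_bounded_op.rep_eq[of "rank_one y x + _"] m_def[symmetric]
    by (intro onorm_bound) simp_all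
qed


section \<open>Coordinate restrictions\<close>

lift_definition restrict_coords ::
    "nat set \<Rightarrow> (nat \<Rightarrow>\<^sub>C 'b::complex_normed_vector) \<Rightarrow> nat \<Rightarrow>\<^sub>C 'b"
  is "\<lambda>S f n. if n \<in> S then f n else 0"
proof -
  fix S :: "nat set" and f :: "nat \<Rightarrow> 'b"
  assume "f \<in> bcontfun"
  then have "bounded (insert 0 (range f))"
    by (simp add: bcontfun_def)
  then have "bounded (range (\<lambda>n. if n \<in> S then f n else 0))"
    by (rule bounded_subset) auto
  then show "(\<lambda>n. if n \<in> S then f n else 0) \<in> bcontfun"
    by (simp add: bcontfun_def continuous_on_discrete)
qed

abbreviation single :: "nat \<Rightarrow> 'b::complex_normed_vector \<Rightarrow> nat \<Rightarrow>\<^sub>C 'b"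
  where "single n X \<equiv> restrict_coords {n} (const_bcontfun X)"

lemmas coordinate_simps [simp] =
  restrict_coords.rep_eq const_bcontfun.rep_eq plus_bcontfun.rep_eq minus_bcontfun.rep_eq
  zero_bcontfun.rep_eq scaleC_bcontfun.rep_eq times_bcontfun.rep_eq

lemma norm_single [simp]: "norm (single n X) = norm X"
proof (rule antisym)
  show "norm (single n X) \<le> norm X"
    by (rule norm_bound) simp
  show "norm X \<le> norm (single n X)"
    using norm_bounded[of "single n X" n] by simp
qed

lemma single_eq_0_iff [simp]: "single n X = 0 \<longleftrightarrow> X = 0"
  by (metis norm_single norm_eq_zero)

lemma restrict_coords_singleton: "restrict_coords {n} A = single n (apply_bcontfun A n)"
  by (rule bcontfun_eqI) simp

lemma clinear_restrict_coords: "clinear (restrict_coords S)"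
  unfolding clinear_iff by (auto intro!: bcontfun_eqI simp: complex_vector.scale_zero_right)

text \<open>As the disjunction holds for each pair \<open>A, B\<close>, at a given coordinate one of its sides holds
  for all sequences. This is the form in which indecomposability of \<open>\<B>(\<H>)\<close> will be used.\<close>

lemma coordinate_dichotomy_imp_restrict:
  fixes Q :: "(nat \<Rightarrow>\<^sub>C 'b::complex_normed_vector) \<Rightarrow> nat \<Rightarrow>\<^sub>C 'b"
  assumes "\<And>A B n. apply_bcontfun (Q A) n = 0 \<or> apply_bcontfun (B - Q B) n = 0"
  shows "\<exists>S. \<forall>A. Q A = restrict_coords S A"
proof (intro exI allI bcontfun_eqI)
  fix A n
  show "apply_bcontfun (Q A) n
      = apply_bcontfun (restrict_coords {n. \<forall>B. apply_bcontfun (B - Q B) n = 0} A) n"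
    using assms[of A n] by auto
qed


section \<open>Bimodule idempotents\<close>

text \<open>The ranges of \<open>Q\<close> and \<open>1 - Q\<close> are complementary ideals that annihilate each other, whatever
  stands between them; primeness then excludes that both are nonzero at the same coordinate.\<close>

lemma bimodule_idempotent_is_restriction:
  fixes Q :: "(nat \<Rightarrow>\<^sub>C 'h::complex_inner bounded_op) \<Rightarrow> nat \<Rightarrow>\<^sub>C 'h bounded_op"
  assumes lin: "clinear Q" and idem: "\<And>A. Q (Q A) = Q A"
    and left: "\<And>A B. Q (A * B) = A * Q B" and right: "\<And>A B. Q (A * B) = Q A * B"
  shows "\<exists>S. \<forall>A. Q A = restrict_coords S A"
proof (rule coordinate_dichotomy_imp_restrict)
  fix A B n
  have "Q A * C * (B - Q B) = 0" for C
  proof -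
    have "Q A * C * (B - Q B) = Q (A * C * (B - Q B))"
      by (simp only: right)
    also have "\<dots> = A * C * (Q B - Q (Q B))"
      by (simp only: left linear_diff[OF clinear_imp_linear[OF lin]])
    finally show ?thesis
      by (simp add: idem)
  qed
  then have "apply_bcontfun (Q A * const_bcontfun C * (B - Q B)) n = 0" for C
    by simp
  then show "apply_bcontfun (Q A) n = 0 \<or> apply_bcontfun (B - Q B) n = 0"
    by (intro bounded_op_prime) simp
qed


section \<open>M-projections\<close>

text \<open>For linear idempotents, this inequality is equivalent to the usual
  \<open>\<parallel>A\<parallel> = max \<parallel>Q A\<parallel> \<parallel>A - Q A\<parallel>\<close>. With two independent sequences \<open>A\<close> and \<open>B\<close> it allows changing one
  summand of a sequence without losing control of the norm.\<close>

definition M_projection :: "('a::complex_normed_vector \<Rightarrow> 'a) \<Rightarrow> bool"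
  where "M_projection Q \<longleftrightarrow> clinear Q \<and> (\<forall>A. Q (Q A) = Q A) \<and>
    (\<forall>A B. norm (Q A + (B - Q B)) \<le> max (norm A) (norm B))"

lemma M_projection_restrict_coords:
  "M_projection (restrict_coords S :: (nat \<Rightarrow>\<^sub>C 'a::complex_normed_vector) \<Rightarrow> _)"
proof -
  have "norm (restrict_coords S A + (B - restrict_coords S B)) \<le> max (norm A) (norm B)"
    for A B :: "nat \<Rightarrow>\<^sub>C 'a"
    by (rule norm_bound) (simp add: norm_bounded le_max_iff_disj)
  then show ?thesis
    by (simp add: M_projection_def clinear_restrict_coords) (auto intro: bcontfun_eqI)
qed

text \<open>Rotating \<open>t\<close> so that \<open>t q > 0\<close> makes the left side grow linearly, the right side only
  quadratically.\<close>

lemma eq_0_if_first_order_bounded: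
  fixes q :: complex
  assumes "\<And>t. (cmod (1 + t * q))\<^sup>2 \<le> 1 + K * (cmod t)\<^sup>2"
  shows "q = 0"
proof (rule ccontr)
  assume "q \<noteq> 0"
  then have q: "(cmod q)\<^sup>2 > 0" by simp
  define s where "s = 1 / (\<bar>K\<bar> + 1)"
  have s: "s > 0" "s * K < 2" by (auto simp: s_def field_simps)
  have "1 + complex_of_real s * cnj q * q = complex_of_real (1 + s * (cmod q)\<^sup>2)"
    by (simp add: complex_norm_square mult.assoc mult.commute del: of_real_power)
  then have "(1 + s * (cmod q)\<^sup>2)\<^sup>2 \<le> 1 + K * (s * cmod q)\<^sup>2"
    using assms[of "complex_of_real s * cnj q"] s
    by (simp only: norm_of_real) (simp add: norm_mult)
  then have "2 * s * (cmod q)\<^sup>2 + (s * (cmod q)\<^sup>2)\<^sup>2 \<le> s * (cmod q)\<^sup>2 * (s * K)"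
    by (simp add: power2_eq_square algebra_simps)
  moreover have "s * (cmod q)\<^sup>2 * (s * K) < s * (cmod q)\<^sup>2 * 2"
    using s q by (intro mult_strict_left_mono) auto
  ultimately show False
    using zero_le_power2[of "s * (cmod q)\<^sup>2"] by linarith
qed

text \<open>The coordinates other than \<open>n\<close> see only \<open>t A\<close>, so they contribute to second order too.\<close>

lemma norm_single_rank_one_perturbation:
  fixes x y :: "'h::complex_inner" and A :: "nat \<Rightarrow>\<^sub>C 'h bounded_op"
  assumes x: "norm x = 1" and y: "norm y = 1" and A: "cinner (op_apply (apply_bcontfun A n) x) y = 0"
  shows "norm (single n (rank_one y x) + t *\<^sub>C A) \<le> sqrt (1 + 2 * (cmod t * norm A)\<^sup>2)"
proof (rule norm_bound)
  fix k
  have tA: "(cmod t * norm (apply_bcontfun A k))\<^sup>2 \<le> (cmod t * norm A)\<^sup>2"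
    by (intro power_mono mult_left_mono norm_bounded) auto
  show "norm (apply_bcontfun (single n (rank_one y x) + t *\<^sub>C A) k)
      \<le> sqrt (1 + 2 * (cmod t * norm A)\<^sup>2)"
  proof (cases "k = n")
    case True
    then have "norm (apply_bcontfun (single n (rank_one y x) + t *\<^sub>C A) k)
        \<le> sqrt (1 + 2 * (cmod t * norm (apply_bcontfun A k))\<^sup>2)"
      using norm_rank_one_perturbation[OF x y A, of t] by simp
    also have "\<dots> \<le> sqrt (1 + 2 * (cmod t * norm A)\<^sup>2)"
      using tA by simp
    finally show ?thesis .
  next
    case False
    have "(cmod t * norm (apply_bcontfun A k))\<^sup>2 \<le> 1 + 2 * (cmod t * norm A)\<^sup>2"
      using tA zero_le_power2[of "cmod t * norm A"] by linarith
    with False show ?thesis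
      by (simp add: norm_scaleC real_le_rsqrt)
  qed
qed

text \<open>The vector functional \<open>f\<close> is an extreme point of the dual unit ball, and such points lie in
  one of the two summands of the decomposition dual to \<open>Q\<close>. The proof does not go through the dual
  space: it shows that \<open>Q\<close> preserves the kernel of \<open>f\<close>, by comparing the norms of
  \<open>R + t A\<close> and \<open>R + t Q(A)\<close>.\<close>

lemma M_projection_eigenfunctional:
  fixes Q :: "(nat \<Rightarrow>\<^sub>C 'h::complex_inner bounded_op) \<Rightarrow> nat \<Rightarrow>\<^sub>C 'h bounded_op"
  assumes Q: "M_projection Q" and x: "norm x = 1" and y: "norm y = 1"
  obtains c :: complex where "c = 0 \<or> c = 1"
    and "\<And>A. cinner (op_apply (apply_bcontfun (Q A) n) x) y
          = c * cinner (op_apply (apply_bcontfun A n) x) y"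
proof -
  define f where "f A = cinner (op_apply (apply_bcontfun A n) x) y" for A :: "nat \<Rightarrow>\<^sub>C 'h bounded_op"
  define R where "R = single n (rank_one y x)"
  have Q_add: "Q (A + B) = Q A + Q B" and Q_scale: "Q (a *\<^sub>C A) = a *\<^sub>C Q A"
    and Q_diff: "Q (A - B) = Q A - Q B" and idem: "Q (Q A) = Q A"
    and Q_norm: "norm (Q A + (B - Q B)) \<le> max (norm A) (norm B)" for A B a
    using Q linear_diff[OF clinear_imp_linear, of Q A B] by (auto simp: M_projection_def clinear_iff)
  have f_add: "f (A + B) = f A + f B" and f_scale: "f (a *\<^sub>C A) = a * f A"
    and f_diff: "f (A - B) = f A - f B" for A B a
    by (simp_all add: f_def cinner_add_left cinner_scaleC_left cinner_diff_left)
  have f_le: "cmod (f A) \<le> norm A" for A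
  proof -
    have "cmod (f A) \<le> norm (op_apply (apply_bcontfun A n) x)"
      unfolding f_def by (rule cmod_cinner_le_unit[OF y])
    also have "\<dots> \<le> norm (apply_bcontfun A n)"
      using norm_op_apply_le[of "apply_bcontfun A n" x] x by simp
    also have "\<dots> \<le> norm A" by (rule norm_bounded)
    finally show ?thesis .
  qed
  have fR: "f R = 1"
    using x y by (simp add: f_def R_def rank_one.rep_eq cinner_scaleC_left cinner_self)
  have kernel: "f (Q A) = 0" if A: "f A = 0" for A
  proof (rule eq_0_if_first_order_bounded)
    fix t
    define b where "b = sqrt (1 + 2 * (cmod t * norm A)\<^sup>2)"
    \<comment> \<open>The instance \<open>t = 0\<close> gives \<open>\<parallel>R\<parallel> \<le> 1\<close>.\<close>
    have "norm (R + t *\<^sub>C A) \<le> b" "norm (R + 0 *\<^sub>C A) \<le> sqrt (1 + 2 * (cmod 0 * norm A)\<^sup>2)"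
      unfolding R_def b_def
      by (rule norm_single_rank_one_perturbation[OF x y A[unfolded f_def]])+
    then have b: "norm (R + t *\<^sub>C A) \<le> b" "norm R \<le> b"
      by (auto simp: b_def complex_vector.scale_zero_left intro: order_trans)
    \<comment> \<open>\<open>R + t Q(A)\<close> has the \<open>Q\<close>-part of \<open>R + t A\<close> and the complementary part of \<open>R\<close>.\<close>
    have "1 + t * f (Q A) = f (Q (R + t *\<^sub>C A) + (R - Q R))"
      by (simp add: Q_add Q_scale f_add f_scale f_diff fR)
    also have "cmod \<dots> \<le> max (norm (R + t *\<^sub>C A)) (norm R)"
      by (rule order_trans[OF f_le Q_norm])
    finally have "cmod (1 + t * f (Q A)) \<le> b"
      using b by simp
    then have "(cmod (1 + t * f (Q A)))\<^sup>2 \<le> b\<^sup>2"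
      by (rule power_mono) simp
    then show "(cmod (1 + t * f (Q A)))\<^sup>2 \<le> 1 + 2 * (norm A)\<^sup>2 * (cmod t)\<^sup>2"
      by (simp add: b_def power_mult_distrib mult_ac)
  qed
  have eigen: "f (Q A) = f (Q R) * f A" for A
    using kernel[of "A - f A *\<^sub>C R"] by (simp add: f_diff f_scale fR Q_diff Q_scale)
  from eigen[of "Q R"] have "f (Q R) = 0 \<or> f (Q R) = 1"
    by (auto simp: idem)
  from this eigen show ?thesis
    by (rule that[unfolded f_def[symmetric]])
qed

text \<open>The eigenvalue in the previous lemma could still vary with \<open>x\<close> and \<open>y\<close>. But for fixed
  \<open>x\<close> every \<open>y\<close> is orthogonal to \<open>U x\<close> or to \<open>V x\<close>, so one of these vectors is zero; hence every
  \<open>x\<close> lies in the kernel of \<open>U\<close> or of \<open>V\<close>, so one of these operators is zero.\<close>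

lemma M_projection_is_restriction:
  fixes Q :: "(nat \<Rightarrow>\<^sub>C 'h::complex_inner bounded_op) \<Rightarrow> nat \<Rightarrow>\<^sub>C 'h bounded_op"
  assumes Q: "M_projection Q"
  shows "\<exists>S. \<forall>A. Q A = restrict_coords S A"
proof (rule coordinate_dichotomy_imp_restrict)
  fix A B n
  define U where "U = apply_bcontfun (Q A) n"
  define V where "V = apply_bcontfun (B - Q B) n"
  have form: "cinner (op_apply U x) y = 0 \<or> cinner (op_apply V x) y = 0" for x y
  proof (cases "x = 0 \<or> y = 0")
    case False
    then obtain x' y' where x': "norm x' = 1" "x = complex_of_real (norm x) *\<^sub>C x'"
      and y': "norm y' = 1" "y = complex_of_real (norm y) *\<^sub>C y'"
      by (metis unit_vector_multiple)
    obtain c where c: "c = 0 \<or> c = 1"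
      "\<And>A. cinner (op_apply (apply_bcontfun (Q A) n) x') y'
          = c * cinner (op_apply (apply_bcontfun A n) x') y'"
      by (rule M_projection_eigenfunctional[OF Q x'(1) y'(1), of n]) blast
    have "cinner (op_apply U x') y' = 0 \<or> cinner (op_apply V x') y' = 0"
      using c(1) by (auto simp: U_def V_def c(2) cinner_diff_left)
    moreover have "cinner (op_apply W x) y
        = complex_of_real (norm x) * (complex_of_real (norm y) * cinner (op_apply W x') y')" for W
      by (subst x'(2), subst y'(2)) (simp add: cinner_scaleC_left cinner_scaleC_right)
    ultimately show ?thesis
      by auto
  qed auto
  have vector: "op_apply U x = 0 \<or> op_apply V x = 0" for x
  proof (rule ccontr)
    assume nz: "\<not> ?thesis"
    have "cinner (op_apply V x) (op_apply U x) = 0"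
      using form[of x "op_apply U x"] nz by simp
    moreover from this have "cinner (op_apply U x) (op_apply V x) = 0"
      using cinner_commute[of "op_apply U x" "op_apply V x"] by simp
    ultimately show False
      using form[of x "op_apply U x - op_apply V x"] nz by (simp add: cinner_diff_right)
  qed
  show "apply_bcontfun (Q A) n = 0 \<or> apply_bcontfun (B - Q B) n = 0"
  proof (rule ccontr)
    assume "\<not> ?thesis"
    then obtain x z where "op_apply U x \<noteq> 0" "op_apply V z \<noteq> 0"
      unfolding U_def[symmetric] V_def[symmetric]
      by (metis bounded_op_eqI zero_bounded_op.rep_eq)
    then show False
      using vector[of x] vector[of z] vector[of "x + z"] by auto
  qed
qed


section \<open>Recovering the permutation\<close>

text \<open>Let \<open>S\<close> be the set that \<open>\<Phi>\<close> assigns to \<open>k\<close> and \<open>T\<close> the one that \<open>\<Phi>\<^sup>-\<^sup>1\<close> assigns to \<open>n\<close>. For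
  \<open>k \<in> T\<close> the map \<open>\<Phi> \<circ> E\<^sub>k\<close> equals \<open>E\<^sub>n \<circ> \<Phi> \<circ> E\<^sub>k\<close>, which is \<open>E\<^sub>n \<circ> \<Phi>\<close> if \<open>n \<in> S\<close> and zero otherwise;
  the latter is excluded by injectivity.\<close>

lemma restriction_pullback:
  fixes \<Phi> \<Psi> :: "(nat \<Rightarrow>\<^sub>C 'b::complex_normed_vector) \<Rightarrow> nat \<Rightarrow>\<^sub>C 'b"
  assumes inv: "\<And>A. \<Psi> (\<Phi> A) = A" "\<And>A. \<Phi> (\<Psi> A) = A" and zero: "\<Phi> 0 = 0"
    and nontrivial: "X \<noteq> (0::'b)"
    and \<Phi>: "\<And>k. \<exists>S. \<forall>A. \<Phi> (restrict_coords {k} A) = restrict_coords S (\<Phi> A)"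
    and \<Psi>: "\<And>n. \<exists>T. \<forall>A. \<Psi> (restrict_coords {n} A) = restrict_coords T (\<Psi> A)"
  shows "\<exists>k. \<forall>A. restrict_coords {n} (\<Phi> A) = \<Phi> (restrict_coords {k} A)"
proof -
  obtain T where "\<And>A. \<Psi> (restrict_coords {n} A) = restrict_coords T (\<Psi> A)"
    using \<Psi> by blast
  then have T: "restrict_coords {n} (\<Phi> A) = \<Phi> (restrict_coords T A)" for A
    using inv(2)[of "restrict_coords {n} (\<Phi> A)"] by (simp add: inv(1))
  have "restrict_coords {n} (\<Phi> (\<Psi> (single n X))) = single n X"
    unfolding inv by (rule bcontfun_eqI) simp
  then have surviving: "restrict_coords {n} (\<Phi> (\<Psi> (single n X))) \<noteq> 0"
    using nontrivial by simp
  have "T \<noteq> {}"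
  proof
    assume "T = {}"
    then have "restrict_coords T A = 0" for A :: "nat \<Rightarrow>\<^sub>C 'b"
      by (intro bcontfun_eqI) simp
    with surviving show False
      by (simp add: T zero)
  qed
  then obtain k where k: "k \<in> T" by blast
  obtain S where S: "\<And>A. \<Phi> (restrict_coords {k} A) = restrict_coords S (\<Phi> A)"
    using \<Phi> by blast
  have comm: "restrict_coords {n} (restrict_coords S A) = (if n \<in> S then restrict_coords {n} A else 0)"
    for A :: "nat \<Rightarrow>\<^sub>C 'b"
    by (rule bcontfun_eqI) auto
  have step: "\<Phi> (restrict_coords {k} A) = (if n \<in> S then restrict_coords {n} (\<Phi> A) else 0)" for A
  proof -
    have "restrict_coords {k} A = restrict_coords T (restrict_coords {k} A)"
      using k by (intro bcontfun_eqI) auto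
    then have "\<Phi> (restrict_coords {k} A) = restrict_coords {n} (restrict_coords S (\<Phi> A))"
      by (simp only: T flip: S)
    then show ?thesis
      by (simp only: comm)
  qed
  have "n \<in> S"
  proof (rule ccontr)
    assume "n \<notin> S"
    then have "\<Phi> (single k X) = \<Phi> 0"
      using step by (simp add: zero)
    then have "single k X = 0"
      by (metis inv(1))
    then show False
      using nontrivial by simp
  qed
  then have "\<forall>A. restrict_coords {n} (\<Phi> A) = \<Phi> (restrict_coords {k} A)"
    by (simp add: step)
  then show ?thesis ..
qed

lemma restriction_permutation:
  fixes \<Phi> \<Psi> :: "(nat \<Rightarrow>\<^sub>C 'b::complex_normed_vector) \<Rightarrow> nat \<Rightarrow>\<^sub>C 'b"
  assumes inv: "\<And>A. \<Psi> (\<Phi> A) = A" "\<And>A. \<Phi> (\<Psi> A) = A" and zero: "\<Phi> 0 = 0"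
    and nontrivial: "X \<noteq> (0::'b)"
    and \<Phi>: "\<And>k. \<exists>S. \<forall>A. \<Phi> (restrict_coords {k} A) = restrict_coords S (\<Phi> A)"
    and \<Psi>: "\<And>n. \<exists>T. \<forall>A. \<Psi> (restrict_coords {n} A) = restrict_coords T (\<Psi> A)"
  obtains \<sigma> where "bij \<sigma>"
    and "\<And>n A. restrict_coords {n} (\<Phi> A) = \<Phi> (restrict_coords {\<sigma> n} A)"
proof -
  have zero': "\<Psi> 0 = 0"
    by (metis inv(1) zero)
  obtain \<sigma> where \<sigma>: "\<And>n A. restrict_coords {n} (\<Phi> A) = \<Phi> (restrict_coords {\<sigma> n} A)"
    using restriction_pullback[OF inv zero nontrivial \<Phi> \<Psi>] by metis
  obtain \<tau> where "\<And>k A. restrict_coords {k} (\<Psi> A) = \<Psi> (restrict_coords {\<tau> k} A)"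
    using restriction_pullback[OF inv(2,1) zero' nontrivial \<Psi> \<Phi>] by metis
  then have \<tau>: "restrict_coords {\<tau> k} (\<Phi> A) = \<Phi> (restrict_coords {k} A)" for k A
    by (metis inv)
  have eq: "m = n" if "\<And>A::nat \<Rightarrow>\<^sub>C 'b. restrict_coords {m} A = restrict_coords {n} A" for m n
    using arg_cong[OF that[of "const_bcontfun X"], of "\<lambda>A. apply_bcontfun A m"] nontrivial
    by (simp split: if_splits)
  have "\<tau> (\<sigma> n) = n" for n
    by (rule eq) (metis \<sigma> \<tau> inv(2))
  moreover have "\<sigma> (\<tau> k) = k" for k
    by (rule eq) (metis \<sigma> \<tau> inv(1))
  ultimately have "bij \<sigma>"
    by (intro o_bij[of \<tau>]) auto
  from this \<sigma> show ?thesis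
    by (rule that)
qed

definition component ::
    "((nat \<Rightarrow>\<^sub>C 'b::complex_normed_vector) \<Rightarrow> nat \<Rightarrow>\<^sub>C 'b) \<Rightarrow> (nat \<Rightarrow> nat) \<Rightarrow> nat \<Rightarrow> 'b \<Rightarrow> 'b"
  where "component \<Phi> \<sigma> n X = apply_bcontfun (\<Phi> (single (\<sigma> n) X)) n"

context
  fixes \<Phi> :: "(nat \<Rightarrow>\<^sub>C 'b::complex_normed_vector) \<Rightarrow> nat \<Rightarrow>\<^sub>C 'b" and \<sigma> :: "nat \<Rightarrow> nat"
  assumes intertwine: "\<And>n A. restrict_coords {n} (\<Phi> A) = \<Phi> (restrict_coords {\<sigma> n} A)"
    and lin: "clinear \<Phi>"
begin

lemma apply_eq_component: "apply_bcontfun (\<Phi> A) n = component \<Phi> \<sigma> n (apply_bcontfun A (\<sigma> n))"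
proof -
  have "apply_bcontfun (\<Phi> A) n = apply_bcontfun (restrict_coords {n} (\<Phi> A)) n"
    by simp
  then show ?thesis
    by (simp only: intertwine component_def restrict_coords_singleton[of "\<sigma> n" A])
qed

lemma image_single: "\<Phi> (single (\<sigma> n) X) = single n (component \<Phi> \<sigma> n X)"
  by (metis intertwine restrict_coords_singleton apply_eq_component const_bcontfun.rep_eq)

lemma clinear_component: "clinear (component \<Phi> \<sigma> n)"
proof -
  have "single m (X + Y) = single m X + single m Y" "single m (c *\<^sub>C X) = c *\<^sub>C single m X"
    for m c and X Y :: 'b
    by (rule bcontfun_eqI, simp add: complex_vector.scale_zero_right)+
  then show ?thesis
    using lin by (simp add: clinear_iff component_def)
qed

lemma surj_component:
  assumes "surj \<Phi>"
  shows "surj (component \<Phi> \<sigma> n)"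
proof (rule surjI)
  fix Y
  show "component \<Phi> \<sigma> n (apply_bcontfun (inv \<Phi> (const_bcontfun Y)) (\<sigma> n)) = Y"
    by (simp add: surj_f_inv_f[OF assms] flip: apply_eq_component)
qed

lemma inj_component:
  assumes "inj \<Phi>"
  shows "inj (component \<Phi> \<sigma> n)"
proof (rule injI)
  fix X Y
  assume "component \<Phi> \<sigma> n X = component \<Phi> \<sigma> n Y"
  then have "\<Phi> (single (\<sigma> n) X) = \<Phi> (single (\<sigma> n) Y)"
    by (simp only: image_single)
  then have "single (\<sigma> n) X = single (\<sigma> n) Y"
    by (rule injD[OF assms])
  from arg_cong[OF this, of "\<lambda>A. apply_bcontfun A (\<sigma> n)"] show "X = Y"
    by simp
qed

end

section \<open>Automorphisms and isometries\<close>

lemma clinear_conjugate: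
  assumes "clinear \<Phi>" "clinear P" "\<And>A. \<Psi> (\<Phi> A) = A" "\<And>A. \<Phi> (\<Psi> A) = A"
  shows "clinear (\<lambda>A. \<Phi> (P (\<Psi> A)))"
proof -
  have "\<Psi> (A + B) = \<Psi> A + \<Psi> B" "\<Psi> (c *\<^sub>C A) = c *\<^sub>C \<Psi> A" for A B c
    using assms(1,3,4) by (metis clinear_iff)+
  with assms(1,2) show ?thesis
    by (simp add: clinear_iff)
qed

lemma algebra_automorphism_inv:
  assumes "algebra_automorphism \<Phi>"
  shows "algebra_automorphism (inv \<Phi>)"
proof -
  have b: "bij \<Phi>" and lin: "clinear \<Phi>" and mult: "\<And>x y. \<Phi> (x * y) = \<Phi> x * \<Phi> y"
    using assms by (auto simp: algebra_automorphism_def)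
  have 1: "inv \<Phi> (\<Phi> x) = x" and 2: "\<Phi> (inv \<Phi> x) = x" for x
    using b by (auto simp: bij_is_inj bij_is_surj surj_f_inv_f)
  have "clinear (inv \<Phi>)"
    using lin 1 2 unfolding clinear_iff by metis
  moreover have "inv \<Phi> (x * y) = inv \<Phi> x * inv \<Phi> y" for x y
    by (metis 1 2 mult)
  ultimately show ?thesis
    using b by (simp add: algebra_automorphism_def bij_imp_bij_inv)
qed

lemma surj_linear_isometry_bij:
  assumes "surj_linear_isometry \<Phi>"
  shows "bij \<Phi>"
  using assms by (metis bij_betw_def dist_eq_0_iff inj_def surj_linear_isometry_def)

lemma surj_linear_isometry_inv:
  assumes "surj_linear_isometry \<Phi>"
  shows "surj_linear_isometry (inv \<Phi>)"
proof -
  have b: "bij \<Phi>" and lin: "clinear \<Phi>" and dist: "\<And>x y. dist (\<Phi> x) (\<Phi> y) = dist x y"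
    using assms surj_linear_isometry_bij by (auto simp: surj_linear_isometry_def)
  have 1: "inv \<Phi> (\<Phi> x) = x" and 2: "\<Phi> (inv \<Phi> x) = x" for x
    using b by (auto simp: bij_is_inj bij_is_surj surj_f_inv_f)
  have "clinear (inv \<Phi>)"
    using lin 1 2 unfolding clinear_iff by metis
  moreover have "dist (inv \<Phi> x) (inv \<Phi> y) = dist x y" for x y
    by (metis 2 dist)
  ultimately show ?thesis
    using b by (simp add: surj_linear_isometry_def bij_imp_bij_inv bij_is_surj)
qed

lemma surj_linear_isometry_norm:
  assumes "surj_linear_isometry \<Phi>"
  shows "norm (\<Phi> A) = norm A"
proof -
  have "\<Phi> 0 = 0"
    using assms by (simp add: surj_linear_isometry_def clinear_imp_linear linear_0)
  then show ?thesis
    using assms by (metis dist_0_norm surj_linear_isometry_def)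
qed

lemma automorphism_maps_restriction:
  fixes \<Phi> :: "(nat \<Rightarrow>\<^sub>C 'h::complex_inner bounded_op) \<Rightarrow> nat \<Rightarrow>\<^sub>C 'h bounded_op"
  assumes "algebra_automorphism \<Phi>"
  shows "\<exists>S. \<forall>A. \<Phi> (restrict_coords K A) = restrict_coords S (\<Phi> A)"
proof -
  have b: "bij \<Phi>" and lin: "clinear \<Phi>" and mult: "\<And>x y. \<Phi> (x * y) = \<Phi> x * \<Phi> y"
    using assms by (auto simp: algebra_automorphism_def)
  have inv1: "inv \<Phi> (\<Phi> A) = A" and inv2: "\<Phi> (inv \<Phi> A) = A" for A
    using b by (auto simp: bij_is_inj bij_is_surj surj_f_inv_f)
  have inv_mult: "inv \<Phi> (A * B) = inv \<Phi> A * inv \<Phi> B" for A B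
    by (metis inv1 inv2 mult)
  have restrict_mult: "restrict_coords K (A * B) = A * restrict_coords K B"
    "restrict_coords K (A * B) = restrict_coords K A * B"
    "restrict_coords K (restrict_coords K A) = restrict_coords K A"
    for A B :: "nat \<Rightarrow>\<^sub>C 'h bounded_op"
    by (rule bcontfun_eqI, simp)+
  have "\<exists>S. \<forall>A. \<Phi> (restrict_coords K (inv \<Phi> A)) = restrict_coords S A"
  proof (rule bimodule_idempotent_is_restriction)
    show "clinear (\<lambda>A. \<Phi> (restrict_coords K (inv \<Phi> A)))"
      by (rule clinear_conjugate[OF lin clinear_restrict_coords inv1 inv2])
    fix A B
    show "\<Phi> (restrict_coords K (inv \<Phi> (\<Phi> (restrict_coords K (inv \<Phi> A)))))
        = \<Phi> (restrict_coords K (inv \<Phi> A))"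
      by (simp only: inv1 restrict_mult(3))
    show "\<Phi> (restrict_coords K (inv \<Phi> (A * B))) = A * \<Phi> (restrict_coords K (inv \<Phi> B))"
      by (simp only: inv_mult restrict_mult(1) mult inv2)
    show "\<Phi> (restrict_coords K (inv \<Phi> (A * B))) = \<Phi> (restrict_coords K (inv \<Phi> A)) * B"
      by (simp only: inv_mult restrict_mult(2) mult inv2)
  qed
  then show ?thesis
    by (metis inv1)
qed

lemma isometry_maps_restriction:
  fixes \<Phi> :: "(nat \<Rightarrow>\<^sub>C 'h::complex_inner bounded_op) \<Rightarrow> nat \<Rightarrow>\<^sub>C 'h bounded_op"
  assumes iso: "surj_linear_isometry \<Phi>"
  shows "\<exists>S. \<forall>A. \<Phi> (restrict_coords K A) = restrict_coords S (\<Phi> A)"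
proof -
  have b: "bij \<Phi>" and lin: "clinear \<Phi>"
    using iso surj_linear_isometry_bij by (auto simp: surj_linear_isometry_def)
  have inv1: "inv \<Phi> (\<Phi> A) = A" and inv2: "\<Phi> (inv \<Phi> A) = A" for A
    using b by (auto simp: bij_is_inj bij_is_surj surj_f_inv_f)
  have inv_norm: "norm (inv \<Phi> A) = norm A" for A
    by (rule surj_linear_isometry_norm[OF surj_linear_isometry_inv[OF iso]])
  have sum: "\<Phi> P + (B - \<Phi> P') = \<Phi> (P + (inv \<Phi> B - P'))" for P P' B
    using lin linear_diff[OF clinear_imp_linear[OF lin]] by (simp add: clinear_iff inv2)
  have "M_projection (\<lambda>A. \<Phi> (restrict_coords K (inv \<Phi> A)))"
    using M_projection_restrict_coords[where 'a="'h bounded_op", of K]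
    by (simp add: M_projection_def clinear_conjugate[OF lin _ inv1 inv2] inv1 sum
        surj_linear_isometry_norm[OF iso]) (metis inv_norm)
  then have "\<exists>S. \<forall>A. \<Phi> (restrict_coords K (inv \<Phi> A)) = restrict_coords S A"
    by (rule M_projection_is_restriction)
  then show ?thesis
    by (metis inv1)
qed

theorem theorem2:
  assumes separable: "separable_space (euclidean :: 'h::complex_hilbert_space topology)"
    and infinite_dimensional: "\<not> (\<exists>S::'h set. finite S \<and> cspan S = UNIV)"
  shows
    "(\<forall>\<Phi> :: (nat \<Rightarrow>\<^sub>C 'h bounded_op) \<Rightarrow> (nat \<Rightarrow>\<^sub>C 'h bounded_op). algebra_automorphism \<Phi> \<longrightarrow>
        (\<exists>(\<phi> :: nat \<Rightarrow> 'h bounded_op \<Rightarrow> 'h bounded_op) (\<sigma> :: nat \<Rightarrow> nat).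
           (\<forall>n. algebra_automorphism (\<phi> n)) \<and> bij \<sigma> \<and>
           (\<forall>A. apply_bcontfun (\<Phi> A) = (\<lambda>n. \<phi> n (apply_bcontfun A (\<sigma> n)))))) \<and>
     (\<forall>\<Phi> :: (nat \<Rightarrow>\<^sub>C 'h bounded_op) \<Rightarrow> (nat \<Rightarrow>\<^sub>C 'h bounded_op). surj_linear_isometry \<Phi> \<longrightarrow>
        (\<exists>(\<phi> :: nat \<Rightarrow> 'h bounded_op \<Rightarrow> 'h bounded_op) (\<sigma> :: nat \<Rightarrow> nat).
           (\<forall>n. surj_linear_isometry (\<phi> n)) \<and> bij \<sigma> \<and>
           (\<forall>A. apply_bcontfun (\<Phi> A) = (\<lambda>n. \<phi> n (apply_bcontfun A (\<sigma> n))))))"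
proof -
  obtain h :: 'h where "h \<noteq> 0"
  proof -
    have "UNIV \<noteq> {0::'h}"
      using infinite_dimensional complex_vector.span_empty by (metis finite.emptyI)
    then show ?thesis
      using that by blast
  qed
  then have "op_apply (rank_one h h) h \<noteq> 0"
    by (simp add: rank_one.rep_eq)
  then have nontrivial: "rank_one h h \<noteq> 0"
    by auto
  show ?thesis
  proof (intro conjI allI impI)
    fix \<Phi> :: "(nat \<Rightarrow>\<^sub>C 'h bounded_op) \<Rightarrow> (nat \<Rightarrow>\<^sub>C 'h bounded_op)"
    assume auto: "algebra_automorphism \<Phi>"
    then have b: "bij \<Phi>" and lin: "clinear \<Phi>" and mult: "\<And>x y. \<Phi> (x * y) = \<Phi> x * \<Phi> y"
      by (auto simp: algebra_automorphism_def)
    obtain \<sigma> where "bij \<sigma>"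
      and \<sigma>: "\<And>n A. restrict_coords {n} (\<Phi> A) = \<Phi> (restrict_coords {\<sigma> n} A)"
    proof (rule restriction_permutation)
      show "inv \<Phi> (\<Phi> A) = A" "\<Phi> (inv \<Phi> A) = A" for A
        using b by (auto simp: bij_is_inj bij_is_surj surj_f_inv_f)
      show "\<Phi> 0 = 0"
        using lin by (simp add: clinear_imp_linear linear_0)
    qed (use nontrivial automorphism_maps_restriction auto algebra_automorphism_inv in blast)+
    have single_mult: "single m (X * Y) = single m X * single m Y" for m and X Y :: "'h bounded_op"
      by (rule bcontfun_eqI) simp
    have "algebra_automorphism (component \<Phi> \<sigma> n)" for n
      unfolding algebra_automorphism_def
    proof (intro conjI allI)
      show "clinear (component \<Phi> \<sigma> n)"
        by (rule clinear_component[OF \<sigma> lin])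
      show "component \<Phi> \<sigma> n (X * Y) = component \<Phi> \<sigma> n X * component \<Phi> \<sigma> n Y" for X Y
        by (simp only: component_def single_mult mult times_bcontfun.rep_eq)
      show "bij (component \<Phi> \<sigma> n)"
        using b by (simp add: bij_def inj_component[OF \<sigma> lin] surj_component[OF \<sigma> lin])
    qed
    with \<open>bij \<sigma>\<close> show "\<exists>\<phi> \<sigma>. (\<forall>n. algebra_automorphism (\<phi> n)) \<and> bij \<sigma> \<and>
        (\<forall>A. apply_bcontfun (\<Phi> A) = (\<lambda>n. \<phi> n (apply_bcontfun A (\<sigma> n))))"
      by (intro exI[of _ "component \<Phi> \<sigma>"] exI[of _ \<sigma>])
         (auto simp: apply_eq_component[OF \<sigma> lin])
  next
    fix \<Phi> :: "(nat \<Rightarrow>\<^sub>C 'h bounded_op) \<Rightarrow> (nat \<Rightarrow>\<^sub>C 'h bounded_op)"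
    assume iso: "surj_linear_isometry \<Phi>"
    then have b: "bij \<Phi>" and lin: "clinear \<Phi>"
      by (auto simp: surj_linear_isometry_bij surj_linear_isometry_def)
    obtain \<sigma> where "bij \<sigma>"
      and \<sigma>: "\<And>n A. restrict_coords {n} (\<Phi> A) = \<Phi> (restrict_coords {\<sigma> n} A)"
    proof (rule restriction_permutation)
      show "inv \<Phi> (\<Phi> A) = A" "\<Phi> (inv \<Phi> A) = A" for A
        using b by (auto simp: bij_is_inj bij_is_surj surj_f_inv_f)
      show "\<Phi> 0 = 0"
        using lin by (simp add: clinear_imp_linear linear_0)
    qed (use nontrivial isometry_maps_restriction iso surj_linear_isometry_inv in blast)+
    have "surj_linear_isometry (component \<Phi> \<sigma> n)" for n
      unfolding surj_linear_isometry_def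
    proof (intro conjI allI)
      show cl: "clinear (component \<Phi> \<sigma> n)"
        by (rule clinear_component[OF \<sigma> lin])
      have "norm (component \<Phi> \<sigma> n X) = norm X" for X
        using surj_linear_isometry_norm[OF iso, of "single (\<sigma> n) X"]
        by (simp add: image_single[OF \<sigma> lin])
      then show "dist (component \<Phi> \<sigma> n X) (component \<Phi> \<sigma> n Y) = dist X Y" for X Y
        by (simp add: dist_norm flip: linear_diff[OF clinear_imp_linear[OF cl]])
      show "surj (component \<Phi> \<sigma> n)"
        using b by (simp add: bij_is_surj surj_component[OF \<sigma> lin])
    qed
    with \<open>bij \<sigma>\<close> show "\<exists>\<phi> \<sigma>. (\<forall>n. surj_linear_isometry (\<phi> n)) \<and> bij \<sigma> \<and>
        (\<forall>A. apply_bcontfun (\<Phi> A) = (\<lambda>n. \<phi> n (apply_bcontfun A (\<sigma> n))))"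
      by (intro exI[of _ "component \<Phi> \<sigma>"] exI[of _ \<sigma>])
         (auto simp: apply_eq_component[OF \<sigma> lin])
  qed
qed

end
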